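(* Let two circles $c_1$ and $c_2$ be given on the elliptic or hyperbolic plane, with centers $C_1,C_2$ and radii $r_1,r_2$, respectively. Then their equioptic curve is the generalized Apollonian curve of the centers $C_1$ and $C_2$ with ratio $$k=\frac{\mathrm{S}(r_1)}{\mathrm{S}(r_2)},$$ where $\mathrm{S}=\sin$ in the elliptic plane and $\mathrm{S}=\sinh$ in the hyperbolic plane.
   Context: Model. Points and lines of the plane are represented by homogeneous coordinates $\mathbf{x}=(x^1:x^2:x^3)$ and $\mathbf{u}=(u_1:u_2:u_3)$. Put $\langle \mathbf{x},\mathbf{y}\rangle = x^1y^1+x^2y^2+\epsilon x^3y^3$, with $\epsilon=+1$ for the elliptic plane and $\epsilon=-1$ for the hyperbolic plane. The distance $d(X,Y)$ of two proper points $X,Y$ represented by $\mathbf{x},\mathbf{y}$ is given by $\mathrm{C}(d(X,Y))=\frac{\epsilon\langle\mathbf{x},\mathbf{y}\rangle}{\sqrt{\langle\mathbf{x},\mathbf{x}\rangle\langle\mathbf{y},\mathbf{y}\rangle}}$, where $\mathrm{C}=\cos$ in the elliptic plane and $\mathrm{C}=\cosh$ in the hyperbolic plane. Viewing angle. The circle with center $C$ and radius $r$ consists of the points at distance $r$ from $C$. The angle $\alpha$ under which it is seen from a point $P$ is the angle $T_1PT_2$ between the two tangents from $P$ to the circle, where $T_1,T_2$ are the points of tangency (so the angle at $P$ between $PC$ and $PT_1$ is $\alpha/2$). Equioptic curve. Given two plane curves $c_1$ and $c_2$, their equioptic curve is the set of points from which $c_1$ and $c_2$ are seen under equal angle. Generalized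 Apollonian curve. A circle of radius $r$ has circumference $2\pi\,\mathrm{S}(r)$. Given two points $A,B$ and $k\in\mathbb{R}^+$, the generalized Apollonian curve of $A$ and $B$ with ratio $k$ is the locus of points $P$ for which the ratio of the circumferences of the circles around $P$ through $A$ and through $B$ is $k$, i.e. $\frac{\mathrm{S}(d(A,P))}{\mathrm{S}(d(B,P))}=k$.
   Formalization: The equioptic curve is proved to be the Apollonian curve without its points lying in both closed discs, from which no two distinct tangents exist and no viewing angle is defined; radii are positive, and less than π/2 in the elliptic plane. *)

theory Defs
  imports "HOL-Analysis.Analysis"
begin

datatype plane = Elliptic | Hyperbolic

fun eps :: "plane \<Rightarrow> real" where
  "eps Elliptic = 1"
| "eps Hyperbolic = -1"

fun S :: "plane \<Rightarrow> real \<Rightarrow> real" where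
  "S Elliptic r = sin r"
| "S Hyperbolic r = sinh r"

text \<open>Points and lines are given by homogeneous coordinate vectors; two vectors denote the same
  point iff they satisfy \<open>same_point\<close>. All sets of points below are sets of coordinate vectors that
  are closed under scaling by nonzero reals.\<close>

definition same_point :: "real^3 \<Rightarrow> real^3 \<Rightarrow> bool" where
  "same_point x y \<longleftrightarrow> (\<exists>c. c \<noteq> 0 \<and> y = c *\<^sub>R x)"

definition form :: "plane \<Rightarrow> real^3 \<Rightarrow> real^3 \<Rightarrow> real" where
  "form g x y = x$1 * y$1 + x$2 * y$2 + eps g * (x$3 * y$3)"

text \<open>In the elliptic plane every nonzero vector is a proper point; in the hyperbolic plane the
  proper points are those inside the absolute conic.\<close>

definition proper :: "plane \<Rightarrow> real^3 \<Rightarrow> bool" where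
  "proper g x \<longleftrightarrow> eps g * form g x x > 0"

definition incident :: "real^3 \<Rightarrow> real^3 \<Rightarrow> bool" where
  "incident u x \<longleftrightarrow> u$1 * x$1 + u$2 * x$2 + u$3 * x$3 = 0"

text \<open>The sign of \<open>eps g * form g x y\<close> depends on the chosen representatives. The absolute value
  amounts to choosing them so that it is nonnegative; thus elliptic distances lie in \<open>[0, pi/2]\<close>
  and hyperbolic representatives are taken on the same sheet of the hyperboloid.\<close>

definition pdist :: "plane \<Rightarrow> real^3 \<Rightarrow> real^3 \<Rightarrow> real" where
  "pdist g x y =
     (let q = \<bar>eps g * form g x y\<bar> / sqrt (form g x x * form g y y)
      in case g of Elliptic \<Rightarrow> arccos q | Hyperbolic \<Rightarrow> arcosh q)"

text \<open>In the elliptic plane the locus at distance \<open>pi/2\<close> from a point is a straight line, and no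
  point has larger distance, so radii are less than \<open>pi/2\<close> there.\<close>

fun is_radius :: "plane \<Rightarrow> real \<Rightarrow> bool" where
  "is_radius Elliptic r \<longleftrightarrow> 0 < r \<and> r < pi / 2"
| "is_radius Hyperbolic r \<longleftrightarrow> 0 < r"

definition circle :: "plane \<Rightarrow> real^3 \<Rightarrow> real \<Rightarrow> (real^3) set" where
  "circle g C r = {X. proper g X \<and> pdist g C X = r}"

text \<open>The closed disc: the points from which the circle is not seen, since no two distinct tangents
  pass through them. An Apollonian curve may contain points lying in both discs (e.g. when two
  congruent circles intersect); these are not on the equioptic curve.\<close>

definition disc :: "plane \<Rightarrow> real^3 \<Rightarrow> real \<Rightarrow> (real^3) set" where
  "disc g C r = {X. proper g X \<and> pdist g C X \<le> r}"

text \<open>For circles with \<open>is_radius g r\<close> a line is tangent iff it has exactly one point in common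
  with the circle.\<close>

definition tangent_at :: "plane \<Rightarrow> real^3 \<Rightarrow> real \<Rightarrow> real^3 \<Rightarrow> real^3 \<Rightarrow> bool" where
  "tangent_at g C r u T \<longleftrightarrow>
     u \<noteq> 0 \<and> T \<in> circle g C r \<and> incident u T \<and>
     (\<forall>X \<in> circle g C r. incident u X \<longrightarrow> same_point T X)"

text \<open>\<open>direction g p x\<close> is the component of \<open>x\<close> orthogonal to \<open>p\<close>, i.e. a tangent vector at \<open>p\<close>
  of the geodesic from \<open>p\<close> towards \<open>x\<close>. Replacing \<open>p\<close> by a multiple does not change it; replacing
  \<open>x\<close> by a positive multiple only rescales it.\<close>

definition direction :: "plane \<Rightarrow> real^3 \<Rightarrow> real^3 \<Rightarrow> real^3" where
  "direction g p x = x - (form g p x / form g p p) *\<^sub>R p"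

definition angle_at :: "plane \<Rightarrow> real^3 \<Rightarrow> real^3 \<Rightarrow> real^3 \<Rightarrow> real" where
  "angle_at g P X Y =
     (let v = direction g P X; w = direction g P Y
      in arccos (form g v w / sqrt (form g v v * form g w w)))"

text \<open>The representatives of \<open>T1\<close>, \<open>T2\<close> are normalised to lie on the same side as \<open>C\<close>. In the
  hyperbolic plane this puts them on one sheet of the hyperboloid; in the elliptic plane, where two
  lines form two supplementary angles, it selects the one containing the circle.\<close>

definition seen_under :: "plane \<Rightarrow> real^3 \<Rightarrow> real \<Rightarrow> real^3 \<Rightarrow> real \<Rightarrow> bool" where
  "seen_under g C r P \<alpha> \<longleftrightarrow>
     (\<exists>u1 u2 T1 T2.
        incident u1 P \<and> tangent_at g C r u1 T1 \<and>
        incident u2 P \<and> tangent_at g C r u2 T2 \<and>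
        \<not> same_point T1 T2 \<and>
        eps g * form g C T1 > 0 \<and> eps g * form g C T2 > 0 \<and>
        \<alpha> = angle_at g P T1 T2)"

definition equioptic_curve ::
    "plane \<Rightarrow> real^3 \<Rightarrow> real \<Rightarrow> real^3 \<Rightarrow> real \<Rightarrow> (real^3) set" where
  "equioptic_curve g C1 r1 C2 r2 =
     {P. proper g P \<and> (\<exists>\<alpha>. seen_under g C1 r1 P \<alpha> \<and> seen_under g C2 r2 P \<alpha>)}"

definition apollonian_curve :: "plane \<Rightarrow> real^3 \<Rightarrow> real^3 \<Rightarrow> real \<Rightarrow> (real^3) set" where
  "apollonian_curve g A B k =
     {P. proper g P \<and> S g (pdist g A P) / S g (pdist g B P) = k}"

end

(* A circle with centre c and radius r < d(c, p) is seen from p under the angle alpha given by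
   sin (alpha / 2) = S(r) / S(d(c, p)); hence two circles are seen under equal angles iff these
   quotients agree. To avoid trigonometry, the circle is treated as the conic
   B(c,x)^2 = C(r)^2 B(c,c) B(x,x), B being the bilinear form of the geometry: the points of
   contact of the tangents from p are its points on the polar line of p, and cos alpha can be
   computed from their Gram matrix as 1 - 2 (S(r) / S(d(c, p)))^2. *)

theory Submission
  imports Defs "HOL-Analysis.Cross3"
begin

unbundle cross3_syntax

section \<open>The bilinear form\<close>

lemma form_add_left: "form g (x + y) z = form g x z + form g y z"
  and form_add_right: "form g z (x + y) = form g z x + form g z y"
  and form_diff_left: "form g (x - y) z = form g x z - form g y z"
  and form_diff_right: "form g z (x - y) = form g z x - form g z y"
  and form_scaleR_left: "form g (a *\<^sub>R x) z = a * form g x z"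
  and form_scaleR_right: "form g z (a *\<^sub>R x) = a * form g z x"
  and form_zero_left: "form g 0 z = 0"
  and form_zero_right: "form g z 0 = 0"
  by (simp_all add: form_def algebra_simps)

lemmas form_linear = form_add_left form_add_right form_diff_left form_diff_right
  form_scaleR_left form_scaleR_right form_zero_left form_zero_right

lemma form_commute: "form g x y = form g y x"
  by (simp add: form_def mult.commute)

lemma eps_cases: "eps g = 1 \<or> eps g = -1"
  by (cases g) auto

text \<open>Sends a line to its pole and a point to its polar line. The same formula serves both
  directions because \<open>eps g\<close> squares to 1. It translates dot and cross products into
  the bilinear form.\<close>

definition polarity :: "plane \<Rightarrow> real^3 \<Rightarrow> real^3" where
  "polarity g x = vector [x$1, x$2, eps g * x$3]"

lemma form_polarity: "form g (polarity g x) y = x \<bullet> y"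
  using eps_cases[of g] by (auto simp: form_def polarity_def inner_vec_def sum_3)

lemma inner_polarity: "polarity g x \<bullet> y = form g x y"
  by (simp add: form_def polarity_def inner_vec_def sum_3)

lemma polarity_eq_0_iff: "polarity g x = 0 \<longleftrightarrow> x = 0"
  using eps_cases[of g] by (auto simp: polarity_def vec_eq_iff forall_3)

lemma incident_iff_inner: "incident u x \<longleftrightarrow> u \<bullet> x = 0"
  by (simp add: incident_def inner_vec_def sum_3)

text \<open>The signature is (3,0) or (2,1), and a proper \<open>c\<close> spans a line on which the
  form has the sign \<open>eps g\<close>. The complement is therefore positive definite in both
  geometries. In the hyperbolic case this is Cauchy-Schwarz in the first two coordinates.\<close>

lemma form_pos_orthogonal:
  assumes "proper g c" and "form g c x = 0" and "x \<noteq> 0"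
  shows "form g x x > 0"
proof (cases g)
  case Elliptic
  have "x$1 \<noteq> 0 \<or> x$2 \<noteq> 0 \<or> x$3 \<noteq> 0"
    using assms(3) by (auto simp: vec_eq_iff forall_3)
  then have "x$1 * x$1 + x$2 * x$2 + x$3 * x$3 > 0"
    by (metis add_nonneg_nonneg add_nonneg_pos add_pos_nonneg not_real_square_gt_zero zero_le_square)
  then show ?thesis using Elliptic by (simp add: form_def)
next
  case Hyperbolic
  define p where "p = (x$1)\<^sup>2 + (x$2)\<^sup>2"
  have c: "(c$1)\<^sup>2 + (c$2)\<^sup>2 < (c$3)\<^sup>2"
    using assms(1) Hyperbolic by (simp add: proper_def form_def power2_eq_square)
  have o: "c$3 * x$3 = c$1 * x$1 + c$2 * x$2"
    using assms(2) Hyperbolic by (simp add: form_def)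
  have c3: "(c$3)\<^sup>2 > 0"
    using c by (smt (verit) zero_le_power2)
  have "p > 0"
  proof (rule ccontr)
    assume "\<not> p > 0"
    then have x12: "x$1 = 0" "x$2 = 0"
      unfolding p_def by (auto simp: not_less sum_power2_le_zero_iff)
    then have "x$3 = 0" using o c3 by simp
    then show False using x12 assms(3) by (auto simp: vec_eq_iff forall_3)
  qed
  have "(c$3)\<^sup>2 * (x$3)\<^sup>2 = (c$1 * x$1 + c$2 * x$2)\<^sup>2"
    using o by (metis power_mult_distrib)
  also have "\<dots> = ((c$1)\<^sup>2 + (c$2)\<^sup>2) * p - (c$1 * x$2 - c$2 * x$1)\<^sup>2"
    unfolding p_def by (simp add: power2_eq_square algebra_simps)
  also have "\<dots> \<le> ((c$1)\<^sup>2 + (c$2)\<^sup>2) * p" by simp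
  also have "\<dots> < (c$3)\<^sup>2 * p" using c \<open>p > 0\<close> by simp
  finally have "(x$3)\<^sup>2 < p" using c3 by simp
  then show ?thesis using Hyperbolic
    by (simp add: form_def p_def power2_eq_square)
qed

text \<open>Lagrange's identity carried over to the form: the Gram determinant of two points
  measures the pole of their joining line.\<close>

lemma form_normal:
  "form g (polarity g (x \<times> y)) (polarity g (x \<times> y)) =
    eps g * (form g x x * form g y y - (form g x y)\<^sup>2)"
  using eps_cases[of g]
  by (auto simp: form_def polarity_def cross3_def power2_eq_square algebra_simps)

text \<open>The pole of the line \<open>cp\<close> is a nonzero vector orthogonal to
  \<open>c\<close>, so the form is positive on it. This is ordinary Cauchy-Schwarz in the elliptic
  plane and the reversed one in the hyperbolic plane.\<close>

lemma gram_pos: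
  assumes "proper g c" and "c \<times> p \<noteq> 0"
  shows "eps g * (form g c c * form g p p - (form g c p)\<^sup>2) > 0"
proof -
  have "form g c (polarity g (c \<times> p)) = 0"
    by (metis form_commute form_polarity dot_cross_self(1) inner_commute)
  then show ?thesis
    using form_pos_orthogonal[OF assms(1)] assms(2) polarity_eq_0_iff
    by (metis form_normal)
qed

lemma cross_eq_0_multiple:
  fixes a b :: "real^3"
  assumes "a \<times> b = 0" and "a \<noteq> 0"
  shows "\<exists>s. b = s *\<^sub>R a"
  using assms by (auto simp: cross_eq_0 collinear_lemma)

lemma gram_nonneg:
  assumes "proper g c"
  shows "eps g * (form g c c * form g p p - (form g c p)\<^sup>2) \<ge> 0"
proof (cases "c \<times> p = 0")
  case True
  have "c \<noteq> 0" using assms by (auto simp: proper_def form_linear)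
  then obtain s where "p = s *\<^sub>R c" using True cross_eq_0_multiple by blast
  then show ?thesis by (simp add: form_linear power2_eq_square)
qed (use gram_pos[OF assms] in force)

lemma in_span_of_common_normal:
  fixes a b u x :: "real^3"
  assumes "a \<times> b \<noteq> 0" and "u \<noteq> 0" and "u \<bullet> a = 0" "u \<bullet> b = 0" "u \<bullet> x = 0"
  shows "\<exists>s t. x = s *\<^sub>R a + t *\<^sub>R b"
proof -
  define n where "n = a \<times> b"
  \<comment> \<open>All coefficients on the right vanish by assumption, and \<open>u\<close> is
    nonzero, so \<open>x\<close> is orthogonal to \<open>n\<close>.\<close>
  have "(x \<bullet> n) *\<^sub>R u = (u \<bullet> x) *\<^sub>R n + (u \<bullet> a) *\<^sub>R (b \<times> x) + (u \<bullet> b) *\<^sub>R (x \<times> a)"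
    unfolding n_def
    by (simp add: vec_eq_iff forall_3 cross3_def inner_vec_def sum_3 algebra_simps)
  then have "x \<bullet> n = 0" using assms by simp
  \<comment> \<open>Cramer's rule in the basis \<open>a\<close>, \<open>b\<close>, \<open>n\<close>,
    whose determinant is \<open>n \<bullet> n\<close>.\<close>
  have "(n \<bullet> n) *\<^sub>R x = ((x \<times> b) \<bullet> n) *\<^sub>R a + ((a \<times> x) \<bullet> n) *\<^sub>R b + (x \<bullet> n) *\<^sub>R n"
    unfolding n_def
    by (simp add: vec_eq_iff forall_3 cross3_def inner_vec_def sum_3 algebra_simps)
  then have e: "(n \<bullet> n) *\<^sub>R x = ((x \<times> b) \<bullet> n) *\<^sub>R a + ((a \<times> x) \<bullet> n) *\<^sub>R b"
    using \<open>x \<bullet> n = 0\<close> by simp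
  have "n \<bullet> n \<noteq> 0" using assms(1) n_def by simp
  then have "x = (1 / (n \<bullet> n)) *\<^sub>R ((n \<bullet> n) *\<^sub>R x)" by simp
  also have "\<dots> = (((x \<times> b) \<bullet> n) / (n \<bullet> n)) *\<^sub>R a + (((a \<times> x) \<bullet> n) / (n \<bullet> n)) *\<^sub>R b"
    unfolding e by (simp add: scaleR_add_right)
  finally show ?thesis by blast
qed

section \<open>Distances and circles\<close>

definition cosine :: "plane \<Rightarrow> real \<Rightarrow> real" where
  "cosine g r = (case g of Elliptic \<Rightarrow> cos r | Hyperbolic \<Rightarrow> cosh r)"

lemma S_square: "(S g r)\<^sup>2 = eps g * (1 - (cosine g r)\<^sup>2)"
  by (cases g) (simp_all add: cosine_def sin_squared_eq sinh_square_eq)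

lemma proper_nonzero: "proper g x \<Longrightarrow> x \<noteq> 0"
  by (auto simp: proper_def form_linear)

lemma form_self_mult_pos:
  assumes "proper g c" and "proper g p"
  shows "form g c c * form g p p > 0"
  using assms eps_cases[of g] by (auto simp: proper_def mult_neg_neg)

text \<open>The Gram inequality puts the quotient \<open>q\<close> into the domain of
  \<open>arccos\<close> or \<open>arcosh\<close>, so that applying the cosine gives \<open>q\<close>
  back. Squaring removes the absolute value and the root.\<close>

lemma pdist_range:
  assumes "proper g c" and "proper g p"
  shows "pdist g c p \<ge> 0" and "g = Elliptic \<Longrightarrow> pdist g c p \<le> pi / 2"
    and "(cosine g (pdist g c p))\<^sup>2 * (form g c c * form g p p) = (form g c p)\<^sup>2"
proof -
  define q where "q = \<bar>eps g * form g c p\<bar> / sqrt (form g c c * form g p p)"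
  note pos = form_self_mult_pos[OF assms]
  have q0: "q \<ge> 0" using pos by (simp add: q_def)
  have q2: "q\<^sup>2 = (form g c p)\<^sup>2 / (form g c c * form g p p)"
    using pos eps_cases[of g] by (auto simp: q_def power_divide)
  have gr: "eps g * (form g c c * form g p p) \<ge> eps g * (form g c p)\<^sup>2"
    using gram_nonneg[OF assms(1), of p] by (simp add: algebra_simps)
  have d: "pdist g c p = (case g of Elliptic \<Rightarrow> arccos q | Hyperbolic \<Rightarrow> arcosh q)"
    by (simp only: pdist_def q_def Let_def)
  have "pdist g c p \<ge> 0 \<and> (g = Elliptic \<longrightarrow> pdist g c p \<le> pi / 2) \<and> cosine g (pdist g c p) = q"
  proof (cases g)
    case Elliptic
    then have "q\<^sup>2 \<le> 1" using gr pos by (simp add: q2)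
    then have "q \<le> 1" by (simp add: power_le_one_iff abs_square_le_1)
    then show ?thesis using Elliptic q0 arccos_le_pi2[of q]
      by (simp add: d[unfolded Elliptic] cosine_def arccos_lbound)
  next
    case Hyperbolic
    then have "q\<^sup>2 \<ge> 1\<^sup>2" using gr pos by (simp add: q2)
    then have "q \<ge> 1" using q0 power2_le_imp_le by blast
    then show ?thesis using Hyperbolic
      by (simp add: d[unfolded Hyperbolic] cosine_def)
  qed
  then show "pdist g c p \<ge> 0" and "g = Elliptic \<Longrightarrow> pdist g c p \<le> pi / 2"
    and "(cosine g (pdist g c p))\<^sup>2 * (form g c c * form g p p) = (form g c p)\<^sup>2"
    using q2 pos by auto
qed

lemma S_pdist_square:
  assumes "proper g c" and "proper g p"
  shows "(S g (pdist g c p))\<^sup>2 * (form g c c * form g p p) =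
    eps g * (form g c c * form g p p - (form g c p)\<^sup>2)"
  unfolding S_square pdist_range(3)[OF assms, symmetric] by (simp add: algebra_simps)

lemma S_radius_pos: "is_radius g r \<Longrightarrow> S g r > 0"
  by (cases g) (auto intro!: sin_gt_zero)

lemma S_pdist_nonneg:
  assumes "proper g c" and "proper g p"
  shows "S g (pdist g c p) \<ge> 0"
  using pdist_range[OF assms] by (cases g) (auto intro!: sin_ge_zero)

text \<open>In the elliptic plane radius and distance both lie in [0, pi/2], where the sine
  increases strictly; \<open>sinh\<close> does so everywhere.\<close>

lemma S_less_iff:
  assumes "proper g c" and "proper g p" and "is_radius g r"
  shows "S g r < S g (pdist g c p) \<longleftrightarrow> r < pdist g c p"
proof (cases g)
  case Elliptic
  then show ?thesis using pdist_range(1,2)[OF assms(1,2)] assms(3)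
    by (simp add: sin_mono_less_eq)
qed (use assms in simp)

lemma S_eq_iff:
  assumes "proper g c" and "proper g p" and "is_radius g r"
  shows "S g (pdist g c p) = S g r \<longleftrightarrow> pdist g c p = r"
proof (cases g)
  case Elliptic
  then show ?thesis using pdist_range[OF assms(1,2)] assms(3)
    by (auto intro: sin_inj_pi)
qed (use assms in simp)

lemma pdist_greater_iff:
  assumes "proper g c" and "proper g p" and "is_radius g r"
  shows "r < pdist g c p \<longleftrightarrow>
    eps g * ((cosine g r)\<^sup>2 * (form g c c * form g p p) - (form g c p)\<^sup>2) > 0"
proof -
  note pos = form_self_mult_pos[OF assms(1,2)]
  have "r < pdist g c p \<longleftrightarrow> (S g r)\<^sup>2 < (S g (pdist g c p))\<^sup>2"
    using S_less_iff[OF assms] S_radius_pos[OF assms(3)] S_pdist_nonneg[OF assms(1,2)]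
    by (smt (verit) power_strict_mono power2_less_imp_less zero_less_numeral)
  also have "\<dots> \<longleftrightarrow> (S g r)\<^sup>2 * (form g c c * form g p p) <
      (S g (pdist g c p))\<^sup>2 * (form g c c * form g p p)"
    by (rule mult_less_cancel_right_pos[OF pos, symmetric])
  also have "\<dots> \<longleftrightarrow> eps g * ((cosine g r)\<^sup>2 * (form g c c * form g p p) - (form g c p)\<^sup>2) > 0"
    unfolding S_pdist_square[OF assms(1,2)] S_square[of g r] by (simp add: algebra_simps)
  finally show ?thesis .
qed

lemma cosine_square_pos: "is_radius g r \<Longrightarrow> (cosine g r)\<^sup>2 > 0"
  using cos_gt_zero[of r] by (cases g) (auto simp: cosine_def)

text \<open>The equation of the conic also makes sense for vectors that are not proper, but no
  nonzero one of these satisfies it. Membership in the circle thus becomes purely algebraic.\<close>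

lemma circle_iff:
  assumes "proper g c" and "is_radius g r"
  shows "x \<in> circle g c r \<longleftrightarrow>
    x \<noteq> 0 \<and> (form g c x)\<^sup>2 = (cosine g r)\<^sup>2 * (form g c c * form g x x)"
proof (cases "proper g x")
  case True
  note pos = form_self_mult_pos[OF assms(1) True]
  have "pdist g c x = r \<longleftrightarrow> (S g (pdist g c x))\<^sup>2 = (S g r)\<^sup>2"
    using S_eq_iff[OF assms(1) True assms(2)] S_radius_pos[OF assms(2)]
      S_pdist_nonneg[OF assms(1) True] by (smt (verit) power2_eq_iff)
  also have "\<dots> \<longleftrightarrow> (S g (pdist g c x))\<^sup>2 * (form g c c * form g x x)
      = (S g r)\<^sup>2 * (form g c c * form g x x)"
    using pos by (metis less_irrefl mult_right_cancel)
  also have "\<dots> \<longleftrightarrow> (form g c x)\<^sup>2 = (cosine g r)\<^sup>2 * (form g c c * form g x x)"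
    unfolding S_pdist_square[OF assms(1) True] S_square[of g r]
    using eps_cases[of g] by (auto simp: algebra_simps)
  finally show ?thesis using True proper_nonzero[OF True] by (simp add: circle_def)
next
  case False
  have "x = 0" if h: "(form g c x)\<^sup>2 = (cosine g r)\<^sup>2 * (form g c c * form g x x)"
  proof -
    \<comment> \<open>The left side of \<open>h\<close> is a square. As \<open>x\<close> is not
      proper, the signs leave only \<open>form g x x = 0\<close>; then \<open>x\<close> is
      orthogonal to \<open>c\<close> as well, where the form is positive definite.\<close>
    have a: "form g c c * form g x x \<ge> 0"
      using h cosine_square_pos[OF assms(2)] by (metis mult_less_0_iff not_less zero_le_power2
        not_less_iff_gr_or_eq)
    have "eps g * form g x x \<le> 0" and "eps g * form g c c > 0"
      using False assms(1) by (auto simp: proper_def)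
    then have "form g x x = 0" using a eps_cases[of g]
      by (auto simp: zero_le_mult_iff)
    then have "form g c x = 0" using h by simp
    then show "x = 0" using form_pos_orthogonal[OF assms(1)] \<open>form g x x = 0\<close> by force
  qed
  then show ?thesis using False by (auto simp: circle_def)
qed

section \<open>Tangents\<close>

text \<open>The polarised equation of the conic: its vanishing at \<open>t\<close> and
  \<open>p\<close> says that \<open>t\<close> lies on the polar line of \<open>p\<close> with
  respect to the circle.\<close>

definition circle_form :: "plane \<Rightarrow> real^3 \<Rightarrow> real \<Rightarrow> real^3 \<Rightarrow> real^3 \<Rightarrow> real" where
  "circle_form g c r x y = form g c x * form g c y - (cosine g r)\<^sup>2 * (form g c c * form g x y)"

lemma circle_iff_circle_form:
  assumes "proper g c" and "is_radius g r"
  shows "x \<in> circle g c r \<longleftrightarrow> x \<noteq> 0 \<and> circle_form g c r x x = 0"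
  unfolding circle_iff[OF assms] circle_form_def by (auto simp: power2_eq_square)

lemma circle_form_combination:
  "circle_form g c r (a *\<^sub>R t + b *\<^sub>R p) (a *\<^sub>R t + b *\<^sub>R p) =
    a\<^sup>2 * circle_form g c r t t + 2 * a * b * circle_form g c r t p + b\<^sup>2 * circle_form g c r p p"
  by (simp add: circle_form_def form_linear form_commute[of g p t] power2_eq_square algebra_simps)

text \<open>If \<open>t\<close> and \<open>p\<close> were not conjugate, the line \<open>tp\<close> would meet the circle in a second point
  \<open>p + a t\<close>.\<close>

lemma tangent_conjugate:
  assumes "proper g c" and "is_radius g r" and "p \<noteq> 0"
    and "tangent_at g c r u t" and "incident u p"
  shows "same_point t p \<or> circle_form g c r t p = 0"
proof (rule ccontr)
  assume "\<not> ?thesis"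
  then have np: "\<not> same_point t p" and nz: "circle_form g c r t p \<noteq> 0" by auto
  \<comment> \<open>With \<open>t\<close> on the circle, \<open>circle_form\<close> at
    \<open>a t + p\<close> is linear in \<open>a\<close>; this is its root.\<close>
  define a where "a = - circle_form g c r p p / (2 * circle_form g c r t p)"
  define x where "x = a *\<^sub>R t + 1 *\<^sub>R p"
  have t: "t \<in> circle g c r" "incident u t"
    and uniq: "\<And>x. x \<in> circle g c r \<Longrightarrow> incident u x \<Longrightarrow> same_point t x"
    using assms(4) by (auto simp: tangent_at_def)
  have np': "p \<noteq> s *\<^sub>R t" for s
    using np assms(3) by (auto simp: same_point_def)
  have "x \<noteq> 0"
  proof
    assume "x = 0"
    then have "p = (- a) *\<^sub>R t" by (simp add: x_def add_eq_0_iff2)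
    then show False using np' by blast
  qed
  moreover have "circle_form g c r x x = 0"
    using t(1) nz circle_iff_circle_form[OF assms(1,2)]
    unfolding x_def circle_form_combination by (simp add: a_def)
  ultimately have "same_point t x"
    using uniq circle_iff_circle_form[OF assms(1,2)] t(2) assms(5)
    by (simp add: x_def incident_iff_inner inner_add_right)
  then obtain s where "x = s *\<^sub>R t" by (auto simp: same_point_def)
  then have "p = (s - a) *\<^sub>R t" by (simp add: x_def algebra_simps)
  then show False using np' by blast
qed

text \<open>On the line \<open>tp\<close> the quadratic form of the circle reduces to the square of
  the coefficient of \<open>p\<close> times its nonzero value at \<open>p\<close>. Hence
  \<open>t\<close> is the only common point.\<close>

lemma tangent_from_conjugate:
  assumes "proper g c" and "is_radius g r" and "p \<noteq> 0"
    and "t \<in> circle g c r" and "circle_form g c r t p = 0" and "circle_form g c r p p \<noteq> 0"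
  shows "tangent_at g c r (t \<times> p) t"
proof -
  have t: "t \<noteq> 0" "circle_form g c r t t = 0"
    using assms(4) circle_iff_circle_form[OF assms(1,2)] by auto
  have tp: "t \<times> p \<noteq> 0"
  proof
    assume "t \<times> p = 0"
    then obtain s where "p = s *\<^sub>R t" using t(1) cross_eq_0_multiple by blast
    then have "circle_form g c r p p = s\<^sup>2 * circle_form g c r t t"
      by (simp add: circle_form_def form_linear power2_eq_square algebra_simps)
    then show False using t(2) assms(6) by simp
  qed
  have "same_point t x" if x: "x \<in> circle g c r" "incident (t \<times> p) x" for x
  proof -
    have "\<exists>a b. x = a *\<^sub>R t + b *\<^sub>R p"
      using x(2) tp by (intro in_span_of_common_normal[where u = "t \<times> p"])
        (auto simp: incident_iff_inner dot_cross_self)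
    then obtain a b where ab: "x = a *\<^sub>R t + b *\<^sub>R p" by blast
    have "x \<noteq> 0" "circle_form g c r x x = 0"
      using x(1) circle_iff_circle_form[OF assms(1,2)] by auto
    then have "b = 0" using t(2) assms(5,6) unfolding ab circle_form_combination by simp
    then show ?thesis using ab \<open>x \<noteq> 0\<close> by (auto simp: same_point_def)
  qed
  then show ?thesis
    using tp assms(4) by (auto simp: tangent_at_def incident_iff_inner dot_cross_self)
qed

section \<open>The viewing angle of a single circle\<close>

lemma angle_at_scale:
  assumes "a > 0" and "b > 0"
  shows "angle_at g p (a *\<^sub>R x) (b *\<^sub>R y) = angle_at g p x y"
proof -
  have dir: "direction g p (s *\<^sub>R z) = s *\<^sub>R direction g p z" for s z
    by (simp add: direction_def form_linear scaleR_diff_right)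
  have "sqrt (a * (a * v) * (b * (b * w))) = a * b * sqrt (v * w)" for v w
  proof -
    have "a * (a * v) * (b * (b * w)) = (a * b)\<^sup>2 * (v * w)"
      by (simp add: power2_eq_square)
    then show ?thesis using assms by (simp add: real_sqrt_mult)
  qed
  then show ?thesis using assms
    by (simp add: angle_at_def dir form_linear Let_def)
qed

text \<open>The points of contact are normalised by \<open>form g c t = form g c c\<close>. Their difference is
  orthogonal to \<open>c\<close>, \<open>p\<close> and their sum, so the sum is a combination of \<open>c\<close> and \<open>p\<close>.\<close>

lemma normalised_contact_points:
  assumes "proper g c" and "proper g p" and "is_radius g r"
    and "circle_form g c r t1 p = 0" "circle_form g c r t1 t1 = 0" "form g c t1 = form g c c"
    and "circle_form g c r t2 p = 0" "circle_form g c r t2 t2 = 0" "form g c t2 = form g c c"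
    and "t1 \<noteq> t2"
  shows "r < pdist g c p"
    and "angle_at g p t1 t2 = arccos (1 - 2 * (S g r / S g (pdist g c p))\<^sup>2)"
proof -
  define N where "N = form g c c"
  define M where "M = form g p p"
  define c' where "c' = form g c p"
  define K where "K = (cosine g r)\<^sup>2"
  \<comment> \<open>\<open>D\<close> is the Gram determinant of \<open>c\<close> and
    \<open>p\<close>. \<open>E\<close> is minus the value of \<open>circle_form\<close> at
    \<open>p\<close>, and \<open>eps g * E > 0\<close> expresses that \<open>p\<close> lies outside
    the circle.\<close>
  define D where "D = N * M - c'\<^sup>2"
  define E where "E = K * (N * M) - c'\<^sup>2"
  have K0: "K > 0" using cosine_square_pos[OF assms(3)] by (simp add: K_def)
  have eK: "eps g * (1 - K) > 0"
    using S_square[of g r] S_radius_pos[OF assms(3)] unfolding K_def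
    by (metis zero_less_power)
  have eN: "eps g * N > 0" and eM: "eps g * M > 0"
    using assms(1,2) by (auto simp: proper_def N_def M_def)
  have N0: "N \<noteq> 0" and M0: "M \<noteq> 0" using eN eM by auto
  have tt: "form g t t = N / K" and tp: "form g t p = c' / K"
    if "circle_form g c r t p = 0" "circle_form g c r t t = 0" "form g c t = form g c c" for t
    using that K0 N0 unfolding circle_form_def N_def[symmetric] c'_def[symmetric] K_def[symmetric]
    by (auto simp: field_simps)
  note t1 = tt[OF assms(4-6)] tp[OF assms(4-6)] assms(6)[folded N_def]
  note t2 = tt[OF assms(7-9)] tp[OF assms(7-9)] assms(9)[folded N_def]
  \<comment> \<open>If \<open>p\<close> were the centre, pairing it with \<open>t1\<close> would
    force \<open>K = 1\<close>, that is \<open>S g r = 0\<close>.\<close>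
  have cp: "c \<times> p \<noteq> 0"
  proof
    assume "c \<times> p = 0"
    then obtain s where s: "p = s *\<^sub>R c"
      using proper_nonzero[OF assms(1)] cross_eq_0_multiple by blast
    have "s \<noteq> 0" using s proper_nonzero[OF assms(2)] by auto
    moreover have "s * N = s * N / K"
      using t1 unfolding c'_def s by (simp add: form_linear form_commute[of g t1 c] N_def)
    ultimately show False using K0 N0 eK by (simp add: field_simps)
  qed
  have eD: "eps g * D > 0"
    using gram_pos[OF assms(1) cp] by (simp add: D_def N_def M_def c'_def)
  then have D0: "D \<noteq> 0" by auto
  have "\<exists>s t. t1 + t2 = s *\<^sub>R c + t *\<^sub>R p"
    using cp
  proof (rule in_span_of_common_normal)
    show "polarity g (t1 - t2) \<noteq> 0" using assms(10) by (simp add: polarity_eq_0_iff)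
    show "polarity g (t1 - t2) \<bullet> c = 0" "polarity g (t1 - t2) \<bullet> p = 0"
      "polarity g (t1 - t2) \<bullet> (t1 + t2) = 0"
      using t1 t2
      by (simp_all add: inner_polarity form_linear form_commute[of g _ c] form_commute[of g t2 t1])
  qed
  then obtain s t where st: "t1 + t2 = s *\<^sub>R c + t *\<^sub>R p" by blast
  define w where "w = form g t1 t2"
  \<comment> \<open>Pairing the sum with \<open>c\<close>, with \<open>p\<close> and with itself
    gives three equations for \<open>s\<close>, \<open>t\<close> and the unknown Gram entry
    \<open>w\<close>.\<close>
  have e1: "s * N + t * c' = 2 * N"
    using arg_cong[OF st, of "form g c"] t1 t2 by (simp add: form_linear N_def c'_def)
  have e2: "s * c' + t * M = 2 * c' / K"
    using arg_cong[OF st, of "\<lambda>x. form g x p"] t1 t2 by (simp add: form_linear M_def c'_def)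
  have e3: "N / K + w = N * s + c' / K * t"
  proof -
    have "form g (t1 + t2) (t1 + t2) = form g (t1 + t2) (s *\<^sub>R c + t *\<^sub>R p)"
      by (simp only: st)
    then have "(N / K + w) + (w + N / K) = s * (N + N) + t * (c' / K + c' / K)"
      using t1 t2
      by (simp add: form_linear w_def form_commute[of g t2 t1] form_commute[of g _ c])
    moreover have "s * (N + N) = 2 * (N * s)" "t * (c' / K + c' / K) = 2 * (c' / K * t)"
      by simp_all
    ultimately show ?thesis by linarith
  qed
  have tD: "t * D = 2 * c' * N * (1 - K) / K"
  proof -
    have "t * D = N * (s * c' + t * M) - c' * (s * N + t * c')"
      by (simp add: D_def power2_eq_square algebra_simps)
    then show ?thesis unfolding e1 e2 using K0 by (simp add: field_simps)
  qed
  \<comment> \<open>This is half the value of the form on \<open>t1 - t2\<close>. That vector is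
    nonzero and orthogonal to \<open>c\<close>, so positivity will yield the sign of
    \<open>E\<close>.\<close>
  have w: "N / K - w = 2 * (1 - K) * N * E / (K\<^sup>2 * D)"
  proof -
    have "N / K - w = 2 * (N / K) - N * s - c' / K * t" using e3 by linarith
    also have "\<dots> = 2 * N / K - 2 * N - t * c' * (1 - K) / K"
    proof -
      have ns: "N * s = 2 * N - t * c'" using e1 by (simp add: algebra_simps)
      show ?thesis unfolding ns using K0 by (simp add: field_simps)
    qed
    finally have "(N / K - w) * D = (2 * N / K - 2 * N - t * c' * (1 - K) / K) * D"
      by (simp only:)
    also have "\<dots> = (2 * N / K - 2 * N) * D - (t * D) * c' * (1 - K) / K"
      using K0 by (simp add: field_simps)
    also have "\<dots> = 2 * (1 - K) * N * E / K\<^sup>2"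
      unfolding tD using K0 by (simp add: D_def E_def field_simps power2_eq_square)
    finally have "N / K - w = 2 * (1 - K) * N * E / K\<^sup>2 / D"
      by (simp only: nonzero_eq_divide_eq[OF D0])
    then show ?thesis by (simp only: divide_divide_eq_left)
  qed
  have KN: "(1 - K) * N > 0"
    using eK eN eps_cases[of g] by (auto simp: mult_neg_neg)
  have "form g (t1 - t2) (t1 - t2) > 0"
    using assms(10) t1 t2 by (intro form_pos_orthogonal[OF assms(1)]) (auto simp: form_linear)
  then have "N / K - w > 0"
    using t1 t2 by (simp add: form_linear w_def form_commute[of g t2 t1])
  then have "0 < (2 * ((1 - K) * N) / K\<^sup>2) * (E / D)"
    unfolding w using K0 D0 by (simp add: field_simps)
  moreover have "2 * ((1 - K) * N) / K\<^sup>2 > 0" using KN K0 by simp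
  ultimately have "E / D > 0" by (rule zero_less_mult_pos)
  then have eE: "eps g * E > 0"
    using eD eps_cases[of g] by (auto simp: zero_less_divide_iff)
  then show "r < pdist g c p"
    unfolding pdist_greater_iff[OF assms(1-3)] E_def K_def N_def M_def c'_def .
  have E0: "E \<noteq> 0" using eE by auto
  have dir: "form g (direction g p x) (direction g p y)
      = form g x y - form g x p * form g y p / M" for x y
    using M0 unfolding direction_def M_def[symmetric]
    by (simp add: form_linear form_commute[of g p x] form_commute[of g p y] M_def[symmetric])
  have vv: "N / K - c' / K * (c' / K) / M = E / (K\<^sup>2 * M)"
    using K0 M0 by (simp add: E_def field_simps power2_eq_square)
  have vpos: "E / (K\<^sup>2 * M) > 0"
    using eE eM K0 eps_cases[of g] by (auto simp: zero_less_divide_iff zero_less_mult_iff mult_less_0_iff)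
  \<comment> \<open>Both directions at \<open>p\<close> have the same squared length
    \<open>E / (K\<^sup>2 * M)\<close>. Writing the numerator as this length minus
    \<open>N / K - w\<close> makes \<open>E\<close> cancel.\<close>
  have ratio: "(w - c' / K * (c' / K) / M) / (E / (K\<^sup>2 * M)) = 1 - 2 * ((1 - K) * N * M / D)"
  proof -
    have "w - c' / K * (c' / K) / M = E / (K\<^sup>2 * M) - 2 * (1 - K) * N * E / (K\<^sup>2 * D)"
      unfolding vv[symmetric] w[symmetric] by simp
    then show ?thesis using K0 M0 D0 E0 by (simp add: field_simps)
  qed
  have Ssq: "(S g r / S g (pdist g c p))\<^sup>2 = (1 - K) * N * M / D"
  proof -
    have "(S g (pdist g c p))\<^sup>2 * (N * M) = eps g * D"
      using S_pdist_square[OF assms(1,2)] by (simp add: N_def M_def D_def c'_def)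
    then have "(S g (pdist g c p))\<^sup>2 = eps g * D / (N * M)"
      using N0 M0 by (simp add: field_simps)
    then show ?thesis unfolding power_divide S_square[of g r] K_def[symmetric]
      using eps_cases[of g] by auto
  qed
  have d1: "form g (direction g p t1) (direction g p t1) = E / (K\<^sup>2 * M)"
    "form g (direction g p t2) (direction g p t2) = E / (K\<^sup>2 * M)"
    "form g (direction g p t1) (direction g p t2) = w - c' / K * (c' / K) / M"
    using t1 t2 by (simp_all only: dir vv w_def)
  have "sqrt (E / (K\<^sup>2 * M) * (E / (K\<^sup>2 * M))) = E / (K\<^sup>2 * M)"
    using vpos by (simp only: real_sqrt_abs2 abs_of_pos)
  then show "angle_at g p t1 t2 = arccos (1 - 2 * (S g r / S g (pdist g c p))\<^sup>2)"
    unfolding angle_at_def Let_def d1 Ssq by (simp only: ratio)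
qed

text \<open>The side condition on the contact points permits positive rescaling to the normalisation
  \<open>form g c t = form g c c\<close>, which leaves the angle unchanged.\<close>

lemma seen_underD:
  assumes "proper g c" and "proper g p" and "is_radius g r" and "seen_under g c r p \<alpha>"
  shows "r < pdist g c p" and "\<alpha> = arccos (1 - 2 * (S g r / S g (pdist g c p))\<^sup>2)"
proof -
  obtain u1 u2 t1 t2 where
    p: "incident u1 p" "incident u2 p" and
    tan: "tangent_at g c r u1 t1" "tangent_at g c r u2 t2" and
    ne: "\<not> same_point t1 t2" and
    sg: "eps g * form g c t1 > 0" "eps g * form g c t2 > 0" and
    a: "\<alpha> = angle_at g p t1 t2"
    using assms(4) unfolding seen_under_def by blast
  have circ: "t1 \<in> circle g c r" "t2 \<in> circle g c r" using tan by (auto simp: tangent_at_def)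
  have t: "circle_form g c r t1 t1 = 0" "circle_form g c r t2 t2 = 0"
    using circ circle_iff_circle_form[OF assms(1,3)] by auto
  note p0 = proper_nonzero[OF assms(2)]
  have sym: "same_point y x" if "same_point x y" for x y
    using that unfolding same_point_def
    by (metis divide_eq_0_iff divideR_right one_neq_zero scaleR_left_imp_eq inverse_eq_divide)
  have tr: "same_point x z" if "same_point x y" "same_point y z" for x y z
    using that unfolding same_point_def by (metis mult_eq_0_iff scaleR_scaleR)
  \<comment> \<open>A point of the circle lying on both tangents would coincide with both contact
    points, which are distinct.\<close>
  have "p \<notin> circle g c r"
    using ne sym tr p tan unfolding tangent_at_def by blast
  moreover have "p \<in> circle g c r" if "same_point t' p" "circle_form g c r t' t' = 0" for t'
    using that p0 unfolding circle_iff_circle_form[OF assms(1,3)]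
    by (auto simp: same_point_def circle_form_def form_linear algebra_simps)
  ultimately have conj: "circle_form g c r t1 p = 0" "circle_form g c r t2 p = 0"
    using tangent_conjugate[OF assms(1,3) p0] tan p t by blast+
  define N where "N = form g c c"
  define a1 where "a1 = N / form g c t1"
  define a2 where "a2 = N / form g c t2"
  have N: "eps g * N > 0" using assms(1) by (simp add: N_def proper_def)
  have pos: "a1 > 0" "a2 > 0" using N sg eps_cases[of g]
    by (auto simp: a1_def a2_def zero_less_divide_iff)
  have sc: "circle_form g c r (s *\<^sub>R x) p = s * circle_form g c r x p"
    "circle_form g c r (s *\<^sub>R x) (s *\<^sub>R x) = s\<^sup>2 * circle_form g c r x x" for s x
    by (simp_all add: circle_form_def form_linear algebra_simps power2_eq_square)
  have nrm: "form g c (a1 *\<^sub>R t1) = form g c c" "form g c (a2 *\<^sub>R t2) = form g c c"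
    using sg by (auto simp: form_linear a1_def a2_def N_def)
  have "a1 *\<^sub>R t1 \<noteq> a2 *\<^sub>R t2"
  proof
    assume "a1 *\<^sub>R t1 = a2 *\<^sub>R t2"
    moreover have "same_point t1 (a1 *\<^sub>R t1)" "same_point t2 (a2 *\<^sub>R t2)"
      using pos unfolding same_point_def by (metis less_irrefl)+
    ultimately show False using ne sym tr by metis
  qed
  note res = normalised_contact_points[OF assms(1-3) _ _ nrm(1) _ _ nrm(2) this]
  show "r < pdist g c p" using res(1) conj t by (simp add: sc)
  show "\<alpha> = arccos (1 - 2 * (S g r / S g (pdist g c p))\<^sup>2)"
    using res(2) conj t unfolding a angle_at_scale[OF pos] by (simp add: sc)
qed

text \<open>The points of contact have the form \<open>h \<plusminus> m n\<close>, where \<open>n\<close> is orthogonal to \<open>c\<close> and \<open>p\<close>;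
  the coefficients of \<open>h\<close> in the span of \<open>c\<close> and \<open>p\<close> solve the linear conditions
  \<open>form g c h = form g c c\<close> and \<open>circle_form g c r h p = 0\<close>.\<close>

lemma seen_under_exists:
  assumes "proper g c" and "proper g p" and "is_radius g r" and "r < pdist g c p"
  shows "\<exists>\<alpha>. seen_under g c r p \<alpha>"
proof -
  define N where "N = form g c c"
  define M where "M = form g p p"
  define c' where "c' = form g c p"
  define K where "K = (cosine g r)\<^sup>2"
  define D where "D = N * M - c'\<^sup>2"
  define E where "E = K * (N * M) - c'\<^sup>2"
  have K0: "K > 0" using cosine_square_pos[OF assms(3)] by (simp add: K_def)
  have eK: "eps g * (1 - K) > 0"
    using S_square[of g r] S_radius_pos[OF assms(3)] unfolding K_def
    by (metis zero_less_power)
  have eN: "eps g * N > 0" using assms(1) by (auto simp: proper_def N_def)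
  have N0: "N \<noteq> 0" using eN by auto
  have NM: "N * M > 0" using form_self_mult_pos[OF assms(1,2)] by (simp add: N_def M_def)
  have eE: "eps g * E > 0"
    using assms(4) unfolding pdist_greater_iff[OF assms(1-3)] E_def K_def N_def M_def c'_def .
  have eD: "eps g * D > 0"
  proof -
    have "eps g * D = eps g * E + (eps g * (1 - K)) * (N * M)"
      by (simp add: D_def E_def algebra_simps)
    then show ?thesis using eE eK NM by (smt (verit) mult_pos_pos)
  qed
  have D0: "D \<noteq> 0" and E0: "E \<noteq> 0" using eD eE by auto
  \<comment> \<open>The condition \<open>form g c h = N\<close> determines \<open>s\<close> from
    \<open>t\<close>. Then \<open>form g h p\<close> equals \<open>c' + t * D / N\<close>, and
    setting this to \<open>c' / K\<close> determines \<open>t\<close>.\<close>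
  define t where "t = c' * N * (1 - K) / (K * D)"
  define s where "s = 1 - t * c' / N"
  define h where "h = s *\<^sub>R c + t *\<^sub>R p"
  define n where "n = polarity g (c \<times> p)"
  have nn: "form g n n = eps g * D"
    unfolding n_def form_normal by (simp add: D_def N_def M_def c'_def)
  have cn: "form g c n = 0" and pn: "form g p n = 0"
    unfolding n_def using form_commute form_polarity by (metis dot_cross_self(1,2) inner_commute)+
  have ch: "form g c h = N"
    unfolding h_def form_linear N_def[symmetric] c'_def[symmetric] s_def using N0 by (simp add: field_simps)
  have hp: "form g h p = c' / K"
  proof -
    have "form g h p = c' + t * D / N"
      unfolding h_def form_linear M_def[symmetric] c'_def[symmetric] s_def D_def
      using N0 by (simp add: field_simps power2_eq_square)
    also have "\<dots> = c' / K" using N0 D0 K0 by (simp add: t_def field_simps)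
    finally show ?thesis .
  qed
  have hn: "form g h n = 0" by (simp add: h_def form_linear cn pn)
  \<comment> \<open>\<open>F\<close> is the amount by which \<open>form g h h\<close> falls short of
    \<open>N / K\<close>, the value required on the circle. The multiple \<open>m\<close> of
    \<open>n\<close> is chosen to supply it.\<close>
  define F where "F = (1 - K) * N * E / (K\<^sup>2 * D)"
  have hh: "form g h h = N / K - F"
  proof -
    have "form g h h = s * form g c h + t * form g h p"
      by (subst (2) h_def) (simp add: form_linear form_commute[of g h c])
    also have "\<dots> = N + t * c' * (1 - K) / K"
      unfolding ch hp s_def using N0 K0 by (simp add: field_simps)
    also have "\<dots> = N / K - F"
      using K0 D0 by (simp add: t_def F_def E_def field_simps) (simp add: D_def power2_eq_square algebra_simps)
    finally show ?thesis .
  qed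
  have "(1 - K) * N > 0" using eK eN eps_cases[of g] by (auto simp: mult_neg_neg)
  moreover have "E / D > 0" using eE eD eps_cases[of g] by (auto simp: divide_neg_neg)
  ultimately have "(1 - K) * N * (E / D) / K\<^sup>2 > 0"
    using K0 by (metis divide_pos_pos mult_pos_pos zero_less_power)
  moreover have "F = (1 - K) * N * (E / D) / K\<^sup>2"
    using K0 D0 by (simp add: F_def field_simps)
  ultimately have F0: "F > 0" by simp
  define m where "m = sqrt (F / (eps g * D))"
  have m0: "m > 0" using F0 eD by (simp add: m_def)
  have mm: "m * m * (eps g * D) = F"
    using F0 eD D0 eps_cases[of g] by (auto simp: m_def)
  have p0: "p \<noteq> 0" by (rule proper_nonzero[OF assms(2)])
  have pp: "circle_form g c r p p \<noteq> 0"
    using E0 by (simp add: circle_form_def E_def N_def M_def c'_def K_def power2_eq_square)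
  have tan: "tangent_at g c r ((h + k *\<^sub>R n) \<times> p) (h + k *\<^sub>R n)"
    and cT: "form g c (h + k *\<^sub>R n) = N" if "k * k = m * m" for k
  proof -
    show cT: "form g c (h + k *\<^sub>R n) = N" by (simp add: form_linear ch cn)
    have "form g (h + k *\<^sub>R n) (h + k *\<^sub>R n) = N / K - F + (k * k) * (eps g * D)"
      by (simp add: form_linear hh hn nn form_commute[of g n h])
    also have "\<dots> = N / K" unfolding that mm by simp
    finally have "form g (h + k *\<^sub>R n) (h + k *\<^sub>R n) = N / K" .
    then have c1: "circle_form g c r (h + k *\<^sub>R n) (h + k *\<^sub>R n) = 0"
      unfolding circle_form_def cT K_def[symmetric] N_def[symmetric] using K0 by simp
    have "form g (h + k *\<^sub>R n) p = c' / K"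
      by (simp add: form_linear hp form_commute[of g n p] pn)
    then have c2: "circle_form g c r (h + k *\<^sub>R n) p = 0"
      unfolding circle_form_def cT K_def[symmetric] N_def[symmetric] c'_def[symmetric] using K0 by simp
    have "h + k *\<^sub>R n \<noteq> 0" using cT N0 by (metis form_zero_right)
    then show "tangent_at g c r ((h + k *\<^sub>R n) \<times> p) (h + k *\<^sub>R n)"
      using c1 c2 pp p0 circle_iff_circle_form[OF assms(1,3)]
      by (intro tangent_from_conjugate[OF assms(1,3)]) auto
  qed
  \<comment> \<open>Both vectors have the same product with \<open>c\<close>, so a factor of
    proportionality must be 1; their products with \<open>n\<close> have opposite signs.\<close>
  have "\<not> same_point (h + m *\<^sub>R n) (h + (- m) *\<^sub>R n)"
  proof
    assume "same_point (h + m *\<^sub>R n) (h + (- m) *\<^sub>R n)"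
    then obtain k where k: "h + (- m) *\<^sub>R n = k *\<^sub>R (h + m *\<^sub>R n)" by (auto simp: same_point_def)
    then have "N = k * N" using cT[of "- m"] cT[of m] by (metis form_scaleR_right minus_mult_minus)
    then have "k = 1" using N0 by simp
    then have "form g (h + (- m) *\<^sub>R n) n = form g (h + m *\<^sub>R n) n"
      using k by (simp only: scaleR_one)
    then have "- m * (eps g * D) = m * (eps g * D)" unfolding form_linear hn nn by simp
    moreover have "m * (eps g * D) > 0" using m0 eD by (rule mult_pos_pos)
    ultimately show False by linarith
  qed
  moreover have "incident (x \<times> p) p" for x by (simp add: incident_iff_inner dot_cross_self)
  ultimately show ?thesis
    unfolding seen_under_def using tan[of m] tan[of "- m"] cT[of m] cT[of "- m"] eN
    by (metis minus_mult_minus)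
qed

section \<open>Comparison of the two circles\<close>

lemma seen_under_iff:
  assumes "proper g c" and "proper g p" and "is_radius g r"
  shows "seen_under g c r p \<alpha> \<longleftrightarrow>
    r < pdist g c p \<and> \<alpha> = arccos (1 - 2 * (S g r / S g (pdist g c p))\<^sup>2)"
  using seen_underD[OF assms] seen_under_exists[OF assms] by blast

theorem theorem4p1:
  fixes g :: plane and C1 C2 :: "real^3" and r1 r2 :: real
  assumes "proper g C1" and "proper g C2"
    and "is_radius g r1" and "is_radius g r2"
  shows "equioptic_curve g C1 r1 C2 r2 =
    apollonian_curve g C1 C2 (S g r1 / S g r2) - (disc g C1 r1 \<inter> disc g C2 r2)"
proof -
  have "(\<exists>\<alpha>. seen_under g C1 r1 P \<alpha> \<and> seen_under g C2 r2 P \<alpha>) \<longleftrightarrow>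
      S g (pdist g C1 P) / S g (pdist g C2 P) = S g r1 / S g r2 \<and>
      \<not> (pdist g C1 P \<le> r1 \<and> pdist g C2 P \<le> r2)" if P: "proper g P" for P
  proof -
    define R1 where "R1 = S g r1"
    define R2 where "R2 = S g r2"
    define D1 where "D1 = S g (pdist g C1 P)"
    define D2 where "D2 = S g (pdist g C2 P)"
    have R: "R1 > 0" "R2 > 0" using assms S_radius_pos by (auto simp: R1_def R2_def)
    have D: "D1 \<ge> 0" "D2 \<ge> 0" using assms P S_pdist_nonneg by (auto simp: D1_def D2_def)
    have less: "r1 < pdist g C1 P \<longleftrightarrow> R1 < D1" "r2 < pdist g C2 P \<longleftrightarrow> R2 < D2"
      using assms P S_less_iff by (auto simp: R1_def R2_def D1_def D2_def)
    have "(\<exists>\<alpha>. seen_under g C1 r1 P \<alpha> \<and> seen_under g C2 r2 P \<alpha>) \<longleftrightarrow>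
        R1 < D1 \<and> R2 < D2 \<and> arccos (1 - 2 * (R1 / D1)\<^sup>2) = arccos (1 - 2 * (R2 / D2)\<^sup>2)"
      unfolding seen_under_iff[OF assms(1) P assms(3)] seen_under_iff[OF assms(2) P assms(4)] less
      unfolding R1_def R2_def D1_def D2_def by auto
    also have "\<dots> \<longleftrightarrow> R1 < D1 \<and> R2 < D2 \<and> R1 / D1 = R2 / D2"
    proof -
      \<comment> \<open>For such arguments \<open>1 - 2 * a\<^sup>2\<close> stays in [-1, 1], where
        \<open>arccos\<close> is injective, and determines the positive number
        \<open>a\<close>.\<close>
      have "arccos (1 - 2 * a\<^sup>2) = arccos (1 - 2 * b\<^sup>2) \<longleftrightarrow> a = b"
        if "0 < a" "a < 1" "0 < b" "b < 1" for a b :: real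
      proof -
        have "a\<^sup>2 \<le> 1" "b\<^sup>2 \<le> 1" using that by (simp_all add: power_le_one)
        then have "arccos (1 - 2 * a\<^sup>2) = arccos (1 - 2 * b\<^sup>2) \<longleftrightarrow> 1 - 2 * a\<^sup>2 = 1 - 2 * b\<^sup>2"
          by (intro arccos_eq_iff) (auto simp: abs_le_iff)
        also have "\<dots> \<longleftrightarrow> a = b" using that by (auto simp: power2_eq_iff)
        finally show ?thesis .
      qed
      from this[of "R1 / D1" "R2 / D2"] show ?thesis using R by auto
    qed
    \<comment> \<open>Equal quotients are both below 1 or both at least 1. So on the Apollonian
      curve a point outside one disc is outside both, and only points in both discs have to be
      removed.\<close>
    also have "\<dots> \<longleftrightarrow> D1 / D2 = R1 / R2 \<and> \<not> (\<not> R1 < D1 \<and> \<not> R2 < D2)"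
    proof (cases "D1 = 0 \<or> D2 = 0")
      \<comment> \<open>Here \<open>D1 / D2\<close> is 0, also by the convention for division by
        zero, whereas \<open>R1 / R2\<close> is positive; both sides are false.\<close>
      case True
      then show ?thesis using R by auto
    next
      case False
      then have D': "D1 > 0" "D2 > 0" using D by auto
      have "R1 / D1 = R2 / D2 \<longleftrightarrow> D1 / D2 = R1 / R2"
        using R D' by (auto simp: field_simps)
      moreover have "R1 / D1 < 1 \<longleftrightarrow> R1 < D1" "R2 / D2 < 1 \<longleftrightarrow> R2 < D2"
        using D' by auto
      ultimately show ?thesis by metis
    qed
    finally show ?thesis
      unfolding less[symmetric] by (simp add: not_less R1_def R2_def D1_def D2_def)
  qed
  then show ?thesis
    by (auto simp: equioptic_curve_def apollonian_curve_def disc_def)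
qed

end
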